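(* (i) For all $n=1,2,\ldots$, the free $n$-generator $\ell$-group $\mathcal A_n$ is hopfian. (ii) Let $\mathfrak q$ be the ideal of $\mathcal A_2$ consisting of all functions in $\mathcal A_2$ that vanish identically over the first quadrant $Q=\{(x,y)\in\mathbb R^2\mid x\ge 0,\ y\ge 0\}$ of $\mathbb R^2$. Then the quotient $\ell$-group $\mathcal A_2/\mathfrak q$ is not hopfian.
   Context: An $\ell$-group is a lattice-ordered abelian group (no distinguished unit is assumed); homomorphisms of $\ell$-groups ($\ell$-homomorphisms) preserve the group and the lattice operations; ideals are kernels of $\ell$-homomorphisms. $\mathcal A_n$ is the $\ell$-group, with pointwise operations, of all continuous piecewise homogeneous linear functions $f\colon\mathbb R^n\to\mathbb R$ (finitely many pieces) where each linear piece has integer coefficients; it is the free $\ell$-group on the $n$ coordinate functions. An $\ell$-group is hopfian if every $\ell$-homomorphism of it onto itself is an automorphism. *)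

theory Defs
  imports "HOL-Analysis.Analysis" "HOL-Algebra.Coset"
begin

section \<open>Lattice-ordered abelian groups\<close>

text \<open>
  The group is written multiplicatively, following \<open>HOL-Algebra\<close>; the lattice order is the
  one given by \<open>x \<le> y \<longleftrightarrow> x \<curlywedge> y = x\<close>, and its translation invariance is
  expressed by distributivity of the group operation over both lattice operations.
\<close>

record 'a lgroup = "'a monoid" +
  lsup :: "'a \<Rightarrow> 'a \<Rightarrow> 'a" (infixl "\<curlyvee>\<index>" 65)
  linf :: "'a \<Rightarrow> 'a \<Rightarrow> 'a" (infixl "\<curlywedge>\<index>" 65)

locale lgroup = comm_group G for G (structure) +
  assumes lsup_closed: "\<lbrakk>x \<in> carrier G; y \<in> carrier G\<rbrakk> \<Longrightarrow> x \<curlyvee> y \<in> carrier G"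
    and linf_closed: "\<lbrakk>x \<in> carrier G; y \<in> carrier G\<rbrakk> \<Longrightarrow> x \<curlywedge> y \<in> carrier G"
    and lsup_comm: "\<lbrakk>x \<in> carrier G; y \<in> carrier G\<rbrakk> \<Longrightarrow> x \<curlyvee> y = y \<curlyvee> x"
    and linf_comm: "\<lbrakk>x \<in> carrier G; y \<in> carrier G\<rbrakk> \<Longrightarrow> x \<curlywedge> y = y \<curlywedge> x"
    and lsup_assoc: "\<lbrakk>x \<in> carrier G; y \<in> carrier G; z \<in> carrier G\<rbrakk>
      \<Longrightarrow> (x \<curlyvee> y) \<curlyvee> z = x \<curlyvee> (y \<curlyvee> z)"
    and linf_assoc: "\<lbrakk>x \<in> carrier G; y \<in> carrier G; z \<in> carrier G\<rbrakk>
      \<Longrightarrow> (x \<curlywedge> y) \<curlywedge> z = x \<curlywedge> (y \<curlywedge> z)"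
    and lsup_absorb: "\<lbrakk>x \<in> carrier G; y \<in> carrier G\<rbrakk> \<Longrightarrow> x \<curlyvee> (x \<curlywedge> y) = x"
    and linf_absorb: "\<lbrakk>x \<in> carrier G; y \<in> carrier G\<rbrakk> \<Longrightarrow> x \<curlywedge> (x \<curlyvee> y) = x"
    and mult_lsup: "\<lbrakk>x \<in> carrier G; y \<in> carrier G; z \<in> carrier G\<rbrakk>
      \<Longrightarrow> z \<otimes> (x \<curlyvee> y) = (z \<otimes> x) \<curlyvee> (z \<otimes> y)"
    and mult_linf: "\<lbrakk>x \<in> carrier G; y \<in> carrier G; z \<in> carrier G\<rbrakk>
      \<Longrightarrow> z \<otimes> (x \<curlywedge> y) = (z \<otimes> x) \<curlywedge> (z \<otimes> y)"

definition lhom :: "('a, 'c) lgroup_scheme \<Rightarrow> ('b, 'd) lgroup_scheme \<Rightarrow> ('a \<Rightarrow> 'b) set" where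
  "lhom G H = {h \<in> hom G H. \<forall>x\<in>carrier G. \<forall>y\<in>carrier G.
     h (x \<curlyvee>\<^bsub>G\<^esub> y) = h x \<curlyvee>\<^bsub>H\<^esub> h y \<and> h (x \<curlywedge>\<^bsub>G\<^esub> y) = h x \<curlywedge>\<^bsub>H\<^esub> h y}"

definition lauto :: "('a, 'c) lgroup_scheme \<Rightarrow> ('a \<Rightarrow> 'a) set" where
  "lauto G = {h \<in> lhom G G. bij_betw h (carrier G) (carrier G)}"

definition hopfian :: "('a, 'c) lgroup_scheme \<Rightarrow> bool" where
  "hopfian G \<longleftrightarrow> (\<forall>h\<in>lhom G G. h ` carrier G = carrier G \<longrightarrow> h \<in> lauto G)"

text \<open>
  The lattice operations on cosets are those of representatives; as with set multiplication in
  \<^term>\<open>G Mod I\<close>, they are written as a union over all representatives, which for an ideal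
  \<open>I\<close> is a union of equal cosets (see \<open>coset_lsup\<close>, \<open>coset_linf\<close> below).
\<close>

definition lquot :: "('a, 'c) lgroup_scheme \<Rightarrow> 'a set \<Rightarrow> 'a set lgroup" (infixl "LMod" 65) where
  "G LMod I = \<lparr>carrier = carrier (G Mod I), monoid.mult = monoid.mult (G Mod I), one = one (G Mod I),
     lsup = (\<lambda>A B. \<Union>x\<in>A. \<Union>y\<in>B. I #>\<^bsub>G\<^esub> (x \<curlyvee>\<^bsub>G\<^esub> y)),
     linf = (\<lambda>A B. \<Union>x\<in>A. \<Union>y\<in>B. I #>\<^bsub>G\<^esub> (x \<curlywedge>\<^bsub>G\<^esub> y))\<rparr>"

text \<open>Ideals are the kernels of homomorphisms; the quotient by an ideal is again an
  \<open>\<ell>\<close>-group.\<close>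

locale lgroup_hom = G?: lgroup G + H?: lgroup H for G (structure) and H (structure) +
  fixes h
  assumes lhom: "h \<in> lhom G H"
begin

sublocale group_hom G H h
  using lhom by unfold_locales (auto simp: lhom_def)

lemma h_lsup: "\<lbrakk>x \<in> carrier G; y \<in> carrier G\<rbrakk> \<Longrightarrow> h (x \<curlyvee> y) = h x \<curlyvee>\<^bsub>H\<^esub> h y"
  and h_linf: "\<lbrakk>x \<in> carrier G; y \<in> carrier G\<rbrakk> \<Longrightarrow> h (x \<curlywedge> y) = h x \<curlywedge>\<^bsub>H\<^esub> h y"
  using lhom by (auto simp: lhom_def)

lemma kernel_coset:
  assumes x: "x \<in> carrier G"
  shows "kernel G H h #> x = {y \<in> carrier G. h y = h x}"
proof (intro equalityI subsetI)
  fix y assume "y \<in> kernel G H h #> x"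
  then show "y \<in> {y \<in> carrier G. h y = h x}"
    using x by (auto simp: r_coset_def kernel_def)
next
  fix y assume y: "y \<in> {y \<in> carrier G. h y = h x}"
  then have "y \<otimes> inv x \<in> kernel G H h" "y = (y \<otimes> inv x) \<otimes> x"
    using x by (auto simp: kernel_def G.m_assoc)
  then show "y \<in> kernel G H h #> x"
    unfolding r_coset_def by blast
qed

lemma coset_lsup:
  assumes "x \<in> carrier G" "y \<in> carrier G"
  shows "(kernel G H h #> x) \<curlyvee>\<^bsub>G LMod kernel G H h\<^esub> (kernel G H h #> y) = kernel G H h #> (x \<curlyvee> y)"
  using assms by (auto simp: lquot_def kernel_coset h_lsup G.lsup_closed)

lemma coset_linf:
  assumes "x \<in> carrier G" "y \<in> carrier G"
  shows "(kernel G H h #> x) \<curlywedge>\<^bsub>G LMod kernel G H h\<^esub> (kernel G H h #> y) = kernel G H h #> (x \<curlywedge> y)"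
  using assms by (auto simp: lquot_def kernel_coset h_linf G.linf_closed)

lemma coset_mult:
  assumes "x \<in> carrier G" "y \<in> carrier G"
  shows "(kernel G H h #> x) \<otimes>\<^bsub>G LMod kernel G H h\<^esub> (kernel G H h #> y) = kernel G H h #> (x \<otimes> y)"
  using assms by (simp add: lquot_def FactGroup_def normal.rcos_sum[OF normal_kernel])

lemma carrier_lquot:
  "A \<in> carrier (G LMod kernel G H h) \<longleftrightarrow> (\<exists>x\<in>carrier G. A = kernel G H h #> x)"
  by (auto simp: lquot_def FactGroup_def RCOSETS_def)

lemma lgroup_lquot: "lgroup (G LMod kernel G H h)"
proof -
  let ?Q = "G LMod kernel G H h"
  have one: "\<one>\<^bsub>?Q\<^esub> = kernel G H h #> \<one>"
    using G.coset_mult_one[OF subgroup.subset[OF subgroup_kernel]]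
    by (simp add: lquot_def)
  have "comm_group ?Q"
  proof (rule comm_groupI)
    fix A assume "A \<in> carrier ?Q"
    then obtain x where "x \<in> carrier G" "A = kernel G H h #> x"
      by (auto simp: carrier_lquot)
    then show "\<exists>B\<in>carrier ?Q. B \<otimes>\<^bsub>?Q\<^esub> A = \<one>\<^bsub>?Q\<^esub>"
      by (intro bexI[of _ "kernel G H h #> inv x"]) (auto simp: carrier_lquot coset_mult one)
  qed (auto simp: carrier_lquot coset_mult one G.m_ac)
  moreover have "A \<curlyvee>\<^bsub>?Q\<^esub> B = B \<curlyvee>\<^bsub>?Q\<^esub> A" "A \<curlywedge>\<^bsub>?Q\<^esub> B = B \<curlywedge>\<^bsub>?Q\<^esub> A"
    if "A \<in> carrier ?Q" "B \<in> carrier ?Q" for A B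
    using that by (auto simp: carrier_lquot coset_lsup coset_linf G.lsup_comm G.linf_comm)
  ultimately show ?thesis
    by (intro lgroup.intro lgroup_axioms.intro)
      (assumption | simp; fail | (auto simp: carrier_lquot coset_mult coset_lsup coset_linf
         G.lsup_closed G.linf_closed G.lsup_assoc G.linf_assoc G.lsup_absorb G.linf_absorb
         G.mult_lsup G.mult_linf)[1])+
qed

end


section \<open>Piecewise homogeneous linear functions with integer coefficients\<close>

definition int_linear :: "(real^'n \<Rightarrow> real) \<Rightarrow> bool" where
  "int_linear l \<longleftrightarrow> (\<exists>a :: int^'n. \<forall>x. l x = (\<Sum>i\<in>UNIV. of_int (a $ i) * x $ i))"

text \<open>
  For a continuous function, being everywhere equal to one of finitely many homogeneous linear
  functions amounts to being linear on each cone of some finite polyhedral subdivision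
  of the space, so the domains of the pieces need not be mentioned.
\<close>

definition piecewise_int_linear :: "(real^'n \<Rightarrow> real) \<Rightarrow> bool" where
  "piecewise_int_linear f \<longleftrightarrow>
     (\<exists>L. finite L \<and> (\<forall>l\<in>L. int_linear l) \<and> (\<forall>x. \<exists>l\<in>L. f x = l x))"

definition free_lgroup :: "(real^'n \<Rightarrow> real) lgroup" where
  "free_lgroup = \<lparr>carrier = {f. continuous_on UNIV f \<and> piecewise_int_linear f},
     monoid.mult = (\<lambda>f g x. f x + g x), one = (\<lambda>x. 0),
     lsup = (\<lambda>f g x. max (f x) (g x)), linf = (\<lambda>f g x. min (f x) (g x))\<rparr>"

definition first_quadrant :: "(real^2) set" where
  "first_quadrant = {v. v $ 1 \<ge> 0 \<and> v $ 2 \<ge> 0}"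

definition quadrant_ideal :: "(real^2 \<Rightarrow> real) set" where
  "quadrant_ideal = {f \<in> carrier free_lgroup. \<forall>v\<in>first_quadrant. f v = 0}"

lemma int_linear_zero: "int_linear (\<lambda>x. 0)"
  unfolding int_linear_def by (intro exI[of _ 0]) simp

lemma int_linear_add:
  fixes f g :: "real^'n \<Rightarrow> real"
  shows "int_linear f \<Longrightarrow> int_linear g \<Longrightarrow> int_linear (\<lambda>x. f x + g x)"
  unfolding int_linear_def
proof (elim exE)
  fix a b :: "int^'n"
  assume "\<forall>x. f x = (\<Sum>i\<in>UNIV. of_int (a $ i) * x $ i)" "\<forall>x. g x = (\<Sum>i\<in>UNIV. of_int (b $ i) * x $ i)"
  then show "\<exists>c :: int^'n. \<forall>x. f x + g x = (\<Sum>i\<in>UNIV. of_int (c $ i) * x $ i)"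
    by (intro exI[of _ "a + b"]) (simp add: sum.distrib distrib_right)
qed

lemma int_linear_uminus:
  fixes f :: "real^'n \<Rightarrow> real"
  shows "int_linear f \<Longrightarrow> int_linear (\<lambda>x. - f x)"
  unfolding int_linear_def
proof (elim exE)
  fix a :: "int^'n"
  assume "\<forall>x. f x = (\<Sum>i\<in>UNIV. of_int (a $ i) * x $ i)"
  then show "\<exists>c :: int^'n. \<forall>x. - f x = (\<Sum>i\<in>UNIV. of_int (c $ i) * x $ i)"
    by (intro exI[of _ "- a"]) (simp add: sum_negf)
qed

lemma piecewise_int_linear_add:
  assumes "piecewise_int_linear f" "piecewise_int_linear g"
  shows "piecewise_int_linear (\<lambda>x. f x + g x)"
proof -
  obtain L M where L: "finite L" "\<forall>l\<in>L. int_linear l" "\<forall>x. \<exists>l\<in>L. f x = l x"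
    and M: "finite M" "\<forall>l\<in>M. int_linear l" "\<forall>x. \<exists>l\<in>M. g x = l x"
    using assms unfolding piecewise_int_linear_def by blast
  let ?N = "(\<lambda>(l, m) x. l x + m x) ` (L \<times> M)"
  have "finite ?N" "\<forall>l\<in>?N. int_linear l"
    using L M by (auto intro: int_linear_add)
  moreover have "\<forall>x. \<exists>l\<in>?N. f x + g x = l x"
  proof
    fix x
    obtain l m where "l \<in> L" "f x = l x" "m \<in> M" "g x = m x"
      using L(3) M(3) by blast
    then show "\<exists>l\<in>?N. f x + g x = l x"
      by (intro bexI[of _ "\<lambda>x. l x + m x"]) auto
  qed
  ultimately show ?thesis
    unfolding piecewise_int_linear_def by blast
qed

lemma piecewise_int_linear_uminus:
  assumes "piecewise_int_linear f"
  shows "piecewise_int_linear (\<lambda>x. - f x)"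
proof -
  obtain L where L: "finite L" "\<forall>l\<in>L. int_linear l" "\<forall>x. \<exists>l\<in>L. f x = l x"
    using assms unfolding piecewise_int_linear_def by blast
  then show ?thesis
    unfolding piecewise_int_linear_def
    by (intro exI[of _ "(\<lambda>l x. - l x) ` L"]) (auto intro: int_linear_uminus)
qed

lemma piecewise_int_linear_choice:
  assumes "piecewise_int_linear f" "piecewise_int_linear g" "\<And>x. h x = f x \<or> h x = g x"
  shows "piecewise_int_linear h"
proof -
  obtain L M where L: "finite L" "\<forall>l\<in>L. int_linear l" "\<forall>x. \<exists>l\<in>L. f x = l x"
    and M: "finite M" "\<forall>l\<in>M. int_linear l" "\<forall>x. \<exists>l\<in>M. g x = l x"
    using assms(1,2) unfolding piecewise_int_linear_def by blast
  have "\<forall>x. \<exists>l\<in>L \<union> M. h x = l x"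
    using L(3) M(3) assms(3) by (metis UnI1 UnI2)
  with L M show ?thesis
    unfolding piecewise_int_linear_def by (intro exI[of _ "L \<union> M"]) auto
qed

lemma lgroup_free_lgroup: "lgroup (free_lgroup :: (real^'n \<Rightarrow> real) lgroup)"
proof -
  have zero: "piecewise_int_linear (\<lambda>x :: real^'n. 0)"
    unfolding piecewise_int_linear_def
    by (intro exI[of _ "{\<lambda>x. 0}"]) (simp add: int_linear_zero)
  have max: "piecewise_int_linear (\<lambda>x. max (f x) (g x))"
    and min: "piecewise_int_linear (\<lambda>x. min (f x) (g x))"
    if "piecewise_int_linear f" "piecewise_int_linear g" for f g :: "real^'n \<Rightarrow> real"
    by (rule piecewise_int_linear_choice[OF that], auto simp: max_def min_def)+
  have "comm_group (free_lgroup :: (real^'n \<Rightarrow> real) lgroup)"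
  proof (rule comm_groupI)
    fix f :: "real^'n \<Rightarrow> real" assume "f \<in> carrier free_lgroup"
    then show "\<exists>g\<in>carrier free_lgroup. g \<otimes>\<^bsub>free_lgroup\<^esub> f = \<one>\<^bsub>free_lgroup\<^esub>"
      by (intro bexI[of _ "\<lambda>x. - f x"])
        (auto simp: free_lgroup_def intro: continuous_intros piecewise_int_linear_uminus)
  qed (auto simp: free_lgroup_def add_ac zero intro: continuous_intros piecewise_int_linear_add)
  then show ?thesis
    by (intro lgroup.intro lgroup_axioms.intro)
      (auto simp: free_lgroup_def max min fun_eq_iff max_add_distrib_right min_add_distrib_right
         intro: continuous_intros)
qed

text \<open>\<^const>\<open>quadrant_ideal\<close> is the kernel of restriction to the first quadrant, with values in the
  \<open>\<ell>\<close>-group of all real functions.\<close>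

definition real_fun_lgroup :: "('a \<Rightarrow> real) lgroup" where
  "real_fun_lgroup = \<lparr>carrier = UNIV, monoid.mult = (\<lambda>f g x. f x + g x), one = (\<lambda>x. 0),
     lsup = (\<lambda>f g x. max (f x) (g x)), linf = (\<lambda>f g x. min (f x) (g x))\<rparr>"

lemma lgroup_real_fun_lgroup: "lgroup (real_fun_lgroup :: ('a \<Rightarrow> real) lgroup)"
proof -
  have "comm_group (real_fun_lgroup :: ('a \<Rightarrow> real) lgroup)"
  proof (rule comm_groupI)
    fix f :: "'a \<Rightarrow> real"
    show "\<exists>g\<in>carrier real_fun_lgroup. g \<otimes>\<^bsub>real_fun_lgroup\<^esub> f = \<one>\<^bsub>real_fun_lgroup\<^esub>"
      by (intro bexI[of _ "\<lambda>x. - f x"]) (auto simp: real_fun_lgroup_def)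
  qed (auto simp: real_fun_lgroup_def add_ac)
  then show ?thesis
    by (intro lgroup.intro lgroup_axioms.intro)
      (auto simp: real_fun_lgroup_def fun_eq_iff max_add_distrib_right min_add_distrib_right)
qed

definition restrict_quadrant :: "(real^2 \<Rightarrow> real) \<Rightarrow> real^2 \<Rightarrow> real" where
  "restrict_quadrant f = (\<lambda>v. if v \<in> first_quadrant then f v else 0)"

lemma restrict_quadrant_hom: "lgroup_hom free_lgroup real_fun_lgroup restrict_quadrant"
  by (intro lgroup_hom.intro lgroup_hom_axioms.intro lgroup_free_lgroup lgroup_real_fun_lgroup)
    (auto simp: lhom_def hom_def restrict_quadrant_def free_lgroup_def real_fun_lgroup_def fun_eq_iff)

lemma quadrant_ideal_eq_kernel:
  "quadrant_ideal = kernel free_lgroup real_fun_lgroup restrict_quadrant"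
  by (auto simp: quadrant_ideal_def kernel_def restrict_quadrant_def real_fun_lgroup_def fun_eq_iff)

lemma lgroup_quotient: "lgroup (free_lgroup LMod quadrant_ideal)"
  unfolding quadrant_ideal_eq_kernel
  by (rule lgroup_hom.lgroup_lquot[OF restrict_quadrant_hom])

end

theory Submission
  imports Defs
begin

text \<open>
  Part (i): a continuous function with finitely many integer linear pieces is a lattice combination
  of these pieces, so an endomorphism \<open>h\<close> is \<open>f \<mapsto> f \<circ> g\<close>, where the components of \<open>g\<close> are the
  images of the coordinates. If \<open>h\<close> is onto, the coordinates factor through \<open>g\<close>, so \<open>g\<close> is
  injective; by invariance of domain its range is a neighbourhood of the origin, and by homogeneity
  \<open>g\<close> is onto. Hence \<open>h\<close> is injective.

  Part (ii): \<open>(x, y) \<mapsto> (x, x + y)\<close> is an integer linear automorphism of the plane that maps the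
  first quadrant properly into itself, so composition with it is a surjective endomorphism of the
  quotient, and it sends the nonzero class of \<open>max 0 (x - y)\<close> to zero.
\<close>

section \<open>Separating pieces and the max-min representation\<close>

text \<open>A piece that crosses a slightly tilted chord upwards starts no higher than
  \<open>f 0\<close> and ends no lower than \<open>f 1 - d\<close>. Since \<open>I\<close> is
  finite, the error \<open>d\<close> can be removed at the end.\<close>

lemma separating_affine_piece:
  fixes f :: "real \<Rightarrow> real" and a b :: "'i \<Rightarrow> real"
  assumes cont: "continuous_on {0..1} f" and fin: "finite I"
    and pieces: "\<And>t. t \<in> {0..1} \<Longrightarrow> \<exists>i\<in>I. f t = a i + b i * t"
  shows "\<exists>i\<in>I. a i \<le> f 0 \<and> f 1 \<le> a i + b i"
proof -
  \<comment> \<open>Tilting the chord by \<open>d\<close> makes \<open>f\<close> end strictly above it; the piece to the right of the last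
    point where \<open>f\<close> is not above the tilted chord then crosses it upwards.\<close>
  have approx: "\<exists>i\<in>I. a i \<le> f 0 \<and> f 1 - d \<le> a i + b i" if "d > 0" for d
  proof -
    define c where "c t = f 0 + (f 1 - f 0 - d) * t" for t
    have cont_c: "continuous_on {0..1} c"
      unfolding c_def by (intro continuous_intros)
    define S where "S = {t\<in>{0..1}. f t \<le> c t}"
    have "closed S"
      unfolding S_def by (rule continuous_on_closed_Collect_le[OF cont cont_c]) simp
    then have "compact ({0..1} \<inter> S)"
      by (intro compact_Int_closed) auto
    moreover have "{0..1} \<inter> S = S"
      by (auto simp: S_def)
    ultimately have "compact S"
      by simp
    moreover have "0 \<in> S"
      by (simp add: S_def c_def)
    ultimately obtain s where s: "s \<in> S" "\<And>t. t \<in> S \<Longrightarrow> t \<le> s"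
      by (metis compact_attains_sup empty_iff)
    have s01: "0 \<le> s" "s < 1"
      using s(1) \<open>d > 0\<close> by (auto simp: S_def c_def less_le)
    \<comment> \<open>Finitely many pieces cover the points to the right of \<open>s\<close>, so one
      of them agrees with \<open>f\<close> at points arbitrarily close to \<open>s\<close> and, by
      continuity, at \<open>s\<close> itself.\<close>
    have "{s<..1} \<subseteq> (\<Union>i\<in>I. {t\<in>{s<..1}. f t = a i + b i * t})"
      using pieces s01 by fastforce
    then have "closure {s<..1} \<subseteq> closure (\<Union>i\<in>I. {t\<in>{s<..1}. f t = a i + b i * t})"
      by (rule closure_mono)
    also have "\<dots> = (\<Union>i\<in>I. closure {t\<in>{s<..1}. f t = a i + b i * t})"
      using fin by (induction I) auto
    finally obtain i where i: "i \<in> I" "s \<in> closure {t\<in>{s<..1}. f t = a i + b i * t}"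
      using s01 by (auto simp: subset_iff)
    have "closed {t\<in>{0..1}. f t - (a i + b i * t) = 0}"
      by (intro continuous_closed_preimage_constant continuous_intros cont)
    then have "closed {t\<in>{0..1}. f t = a i + b i * t}"
      by simp
    then have "closure {t\<in>{s<..1}. f t = a i + b i * t} \<subseteq> {t\<in>{0..1}. f t = a i + b i * t}"
      using s01 by (intro closure_minimal) auto
    with i(2) have fs: "f s = a i + b i * s"
      by blast
    have "{t\<in>{s<..1}. f t = a i + b i * t} \<noteq> {}"
      using i(2) by (metis closure_empty empty_iff)
    then obtain t where t: "s < t" "t \<le> 1" "f t = a i + b i * t"
      by auto
    have "t \<notin> S"
      using s(2) t(1) by force
    then have ct: "c t < f t"
      using s01 t by (auto simp: S_def)
    have cs: "f s \<le> c s"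
      using s(1) by (simp add: S_def)
    \<comment> \<open>\<open>m\<close> is the slope of piece \<open>i\<close> relative to the tilted
      chord. The difference of the two is at most 0 at \<open>s\<close> and positive at
      \<open>t\<close>, so \<open>m > 0\<close>; hence it stays at most 0 back at 0 and positive on
      at 1.\<close>
    define m where "m = b i - (f 1 - f 0 - d)"
    have 1: "a i - f 0 + m * s \<le> 0" "a i - f 0 + m * t > 0"
      using ct cs fs t(3) by (auto simp: c_def m_def algebra_simps)
    then have "m * (t - s) > 0"
      by (simp add: algebra_simps)
    then have "m > 0"
      using t(1) by (simp add: zero_less_mult_iff)
    then have "m * s \<ge> 0" "m * t \<le> m"
      using s01 t by (auto simp: mult_le_cancel_left1)
    with 1 have "a i - f 0 \<le> 0" "a i - f 0 + m > 0"
      by linarith+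
    then show ?thesis
      using i(1) by (intro bexI[of _ i]) (auto simp: m_def)
  qed
  show ?thesis
  proof (rule ccontr)
    assume neg: "\<not> ?thesis"
    define J where "J = {i\<in>I. a i \<le> f 0}"
    have "finite J"
      using fin by (simp add: J_def)
    have "J \<noteq> {}"
      using approx[of 1] by (auto simp: J_def)
    \<comment> \<open>The smallest amount by which a piece with admissible start falls short of
      \<open>f 1\<close>; the approximation with error \<open>e / 2\<close> contradicts it.\<close>
    define e where "e = Min ((\<lambda>i. f 1 - (a i + b i)) ` J)"
    have "e > 0"
      using \<open>finite J\<close> \<open>J \<noteq> {}\<close> neg by (auto simp: e_def J_def not_le)
    then obtain i where i: "i \<in> J" "f 1 - e / 2 \<le> a i + b i"
      using approx[of "e / 2"] by (auto simp: J_def)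
    then have "e \<le> f 1 - (a i + b i)"
      using \<open>finite J\<close> by (auto simp: e_def)
    with i(2) \<open>e > 0\<close> show False
      by linarith
  qed
qed

lemma int_linear_segment:
  assumes "int_linear l"
  shows "l (x + t *\<^sub>R (y - x)) = l x + (l y - l x) * t"
proof -
  obtain a where "\<And>x. l x = (\<Sum>i\<in>UNIV. of_int (a $ i) * x $ i)"
    using assms by (auto simp: int_linear_def)
  then show ?thesis
    by (simp add: sum_distrib_left sum.distrib sum_subtractf algebra_simps)
qed

text \<open>Along the segment from \<open>x\<close> to \<open>y\<close> the pieces become affine in
  one variable. That a single piece serves both points is what bounds the minima in the max-min
  representation from above.\<close>

lemma separating_linear_piece:
  fixes f :: "real^'n \<Rightarrow> real"
  assumes "continuous_on UNIV f" "finite L" "\<And>l. l \<in> L \<Longrightarrow> int_linear l"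
    and "\<And>x. \<exists>l\<in>L. f x = l x"
  shows "\<exists>l\<in>L. l x \<le> f x \<and> f y \<le> l y"
proof -
  have "\<exists>l\<in>L. l x \<le> f (x + 0 *\<^sub>R (y - x)) \<and> f (x + 1 *\<^sub>R (y - x)) \<le> l x + (l y - l x)"
  proof (rule separating_affine_piece)
    show "continuous_on {0..1} (\<lambda>t. f (x + t *\<^sub>R (y - x)))"
      by (intro continuous_on_compose2[OF assms(1)] continuous_intros) auto
    show "\<exists>l\<in>L. f (x + t *\<^sub>R (y - x)) = l x + (l y - l x) * t" for t
      using assms(3,4) by (metis int_linear_segment)
  qed (rule assms(2))
  then show ?thesis
    by simp
qed

lemma finite_Min_closed:
  fixes k :: "'i \<Rightarrow> 'a \<Rightarrow> real"
  assumes "finite T" "T \<noteq> {}" "\<And>t. t \<in> T \<Longrightarrow> P (k t)"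
    and "\<And>f g. P f \<Longrightarrow> P g \<Longrightarrow> P (\<lambda>x. min (f x) (g x))"
  shows "P (\<lambda>x. Min ((\<lambda>t. k t x) ` T))"
  using assms(1-3) by (induction T rule: finite_ne_induct) (auto intro: assms(4))

lemma finite_Max_closed:
  fixes k :: "'i \<Rightarrow> 'a \<Rightarrow> real"
  assumes "finite T" "T \<noteq> {}" "\<And>t. t \<in> T \<Longrightarrow> P (k t)"
    and "\<And>f g. P f \<Longrightarrow> P g \<Longrightarrow> P (\<lambda>x. max (f x) (g x))"
  shows "P (\<lambda>x. Max ((\<lambda>t. k t x) ` T))"
  using assms(1-3) by (induction T rule: finite_ne_induct) (auto intro: assms(4))

text \<open>The max-min representation below is Ovchinnikov's.\<close>

lemma free_lgroup_induct:
  fixes f :: "real^'n \<Rightarrow> real"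
  assumes f: "f \<in> carrier free_lgroup"
    and coord: "\<And>i. P (\<lambda>x. x $ i)"
    and add: "\<And>f g. P f \<Longrightarrow> P g \<Longrightarrow> P (\<lambda>x. f x + g x)"
    and uminus: "\<And>f. P f \<Longrightarrow> P (\<lambda>x. - f x)"
    and max: "\<And>f g. P f \<Longrightarrow> P g \<Longrightarrow> P (\<lambda>x. max (f x) (g x))"
    and min: "\<And>f g. P f \<Longrightarrow> P g \<Longrightarrow> P (\<lambda>x. min (f x) (g x))"
  shows "P f"
proof -
  \<comment> \<open>Index types are nonempty, so zero arises as some coordinate plus its
    negative.\<close>
  have zero: "P (\<lambda>x. 0)"
    using add[OF coord[of undefined] uminus[OF coord[of undefined]]] by simp
  have scaled: "P (\<lambda>x. of_int k * x $ i)" for k :: int and i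
  proof (induction k rule: int_induct[where k = 0])
    case base
    show ?case using zero by simp
  next
    case (step1 k)
    then show ?case using add[OF step1(2) coord[of i]] by (simp add: algebra_simps)
  next
    case (step2 k)
    then show ?case using add[OF step2(2) uminus[OF coord[of i]]] by (simp add: algebra_simps)
  qed
  have sum: "P (\<lambda>x. \<Sum>i\<in>A. of_int (a $ i) * x $ i)" if "finite A" for A and a :: "int^'n"
    using that by (induction A) (auto intro: zero add scaled)
  have linear: "P l" if "int_linear l" for l
  proof -
    obtain a where "l = (\<lambda>x. \<Sum>i\<in>UNIV. of_int (a $ i) * x $ i)"
      using \<open>int_linear l\<close> by (auto simp: int_linear_def)
    then show ?thesis using sum by simp
  qed
  obtain L where L: "finite L" "\<And>l. l \<in> L \<Longrightarrow> int_linear l" "\<And>x. \<exists>l\<in>L. f x = l x"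
    using f unfolding free_lgroup_def piecewise_int_linear_def by auto
  have cont: "continuous_on UNIV f"
    using f by (simp add: free_lgroup_def)
  \<comment> \<open>The pieces dominating \<open>f\<close> at \<open>y\<close>. Their minimum equals
    \<open>f\<close> at \<open>y\<close>, since a piece agreeing with \<open>f\<close> there belongs
    to \<open>S y\<close>, and by separation it is nowhere above \<open>f\<close>. So
    \<open>f\<close> is the maximum of these minima, and only finitely many sets \<open>S y\<close>
    occur because \<open>L\<close> is finite.\<close>
  define S where "S y = {l\<in>L. f y \<le> l y}" for y
  have S: "finite (S y)" "S y \<noteq> {}" for y
    using L(1) L(3)[of y] by (auto simp: S_def)
  have fin: "finite (range S)"
    using L(1) by (auto intro: finite_subset[of _ "Pow L"] simp: S_def)
  have "Max ((\<lambda>T. Min ((\<lambda>l. l z) ` T)) ` range S) = f z" for z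
  proof (rule Max_eqI)
    show "finite ((\<lambda>T. Min ((\<lambda>l. l z) ` T)) ` range S)"
      using fin by simp
  next
    fix r assume "r \<in> (\<lambda>T. Min ((\<lambda>l. l z) ` T)) ` range S"
    then obtain y where r: "r = Min ((\<lambda>l. l z) ` S y)"
      by auto
    obtain l where "l \<in> L" "l z \<le> f z" "f y \<le> l y"
      using separating_linear_piece[OF cont L] by metis
    then show "r \<le> f z"
      using S(1)[of y] by (auto simp: r S_def intro: Min.coboundedI order.trans[OF Min_le])
  next
    obtain l where "l \<in> L" "f z = l z"
      using L(3) by blast
    then have "Min ((\<lambda>l. l z) ` S z) = f z"
      using S(1)[of z] by (intro Min_eqI) (auto simp: S_def)
    then show "f z \<in> (\<lambda>T. Min ((\<lambda>l. l z) ` T)) ` range S"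
      by (metis imageI rangeI)
  qed
  then have "f = (\<lambda>z. Max ((\<lambda>T. Min ((\<lambda>l. l z) ` T)) ` range S))"
    by auto
  moreover have "P (\<lambda>z. Max ((\<lambda>T. Min ((\<lambda>l. l z) ` T)) ` range S))"
  proof (rule finite_Max_closed[where P = P, OF fin _ _ max])
    fix T assume "T \<in> range S"
    then have "finite T" "T \<noteq> {}" "T \<subseteq> L"
      using S by (auto simp: S_def)
    then show "P (\<lambda>z. Min ((\<lambda>l. l z) ` T))"
      using L(2) linear min by (intro finite_Min_closed[where P = P]) auto
  qed auto
  ultimately show "P f"
    by simp
qed

section \<open>Endomorphisms as substitutions, and part (i)\<close>

lemma free_lgroup_homogeneous:
  fixes f :: "real^'n \<Rightarrow> real"
  assumes f: "f \<in> carrier free_lgroup" and "t \<ge> 0"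
  shows "f (t *\<^sub>R x) = t * f x"
proof (rule free_lgroup_induct[OF f, where P = "\<lambda>f. f (t *\<^sub>R x) = t * f x"])
  have "mono ((*) t)"
    using \<open>t \<ge> 0\<close> by (simp add: mono_def mult_left_mono)
  then show "max (f (t *\<^sub>R x)) (g (t *\<^sub>R x)) = t * max (f x) (g x)"
    and "min (f (t *\<^sub>R x)) (g (t *\<^sub>R x)) = t * min (f x) (g x)"
    if "f (t *\<^sub>R x) = t * f x" "g (t *\<^sub>R x) = t * g x" for f g :: "real^'n \<Rightarrow> real"
    using that by (simp_all add: max_of_mono min_of_mono)
qed (simp_all add: distrib_left)

lemma int_linear_coord: "int_linear (\<lambda>x. x $ i)"
  unfolding int_linear_def
  by (intro exI[of _ "axis i 1"]) (simp add: axis_def if_distrib[of of_int]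
       if_distrib[of "\<lambda>c. c * _"] cong: if_cong)

lemma int_linear_in_free_lgroup:
  assumes "int_linear l"
  shows "l \<in> carrier free_lgroup"
proof -
  have "continuous_on UNIV l"
    using assms unfolding int_linear_def by (auto simp: fun_eq_iff[symmetric] intro!: continuous_intros)
  then show ?thesis
    using assms by (auto simp: free_lgroup_def piecewise_int_linear_def intro!: exI[of _ "{l}"])
qed

text \<open>Both sides preserve all operations in \<open>f\<close> and agree on the coordinates,
  which generate.\<close>

lemma free_lgroup_endo_eq_compose:
  fixes f :: "real^'n \<Rightarrow> real" and h :: "(real^'n \<Rightarrow> real) \<Rightarrow> real^'n \<Rightarrow> real"
  assumes h: "h \<in> lhom free_lgroup free_lgroup" and f: "f \<in> carrier free_lgroup"
  shows "h f = (\<lambda>x. f (\<chi> i. h (\<lambda>x. x $ i) x))"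
proof -
  interpret G: lgroup "free_lgroup :: (real^'n \<Rightarrow> real) lgroup"
    by (rule lgroup_free_lgroup)
  interpret lgroup_hom "free_lgroup :: (real^'n \<Rightarrow> real) lgroup" free_lgroup h
    by (intro lgroup_hom.intro lgroup_hom_axioms.intro lgroup_free_lgroup h)
  let ?A = "free_lgroup :: (real^'n \<Rightarrow> real) lgroup"
  \<comment> \<open>Membership is carried through the induction because \<open>h\<close> preserves
    the operations only on the carrier.\<close>
  let ?P = "\<lambda>f. f \<in> carrier ?A \<and> h f = (\<lambda>x. f (\<chi> i. h (\<lambda>x. x $ i) x))"
  have inv: "inv\<^bsub>?A\<^esub> f = (\<lambda>x. - f x)" "(\<lambda>x. - f x) \<in> carrier ?A" if "f \<in> carrier ?A" for f
  proof -
    show "(\<lambda>x. - f x) \<in> carrier ?A"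
      using that by (auto simp: free_lgroup_def intro: continuous_intros piecewise_int_linear_uminus)
    then show "inv\<^bsub>?A\<^esub> f = (\<lambda>x. - f x)"
      using that by (intro G.inv_equality) (auto simp: free_lgroup_def)
  qed
  have ops: "f \<otimes>\<^bsub>?A\<^esub> g = (\<lambda>x. f x + g x)" "f \<curlyvee>\<^bsub>?A\<^esub> g = (\<lambda>x. max (f x) (g x))"
    "f \<curlywedge>\<^bsub>?A\<^esub> g = (\<lambda>x. min (f x) (g x))" for f g
    by (simp_all add: free_lgroup_def)
  from f have "?P f"
  proof (rule free_lgroup_induct)
    show "?P (\<lambda>x. x $ i)" for i
      by (simp add: int_linear_in_free_lgroup int_linear_coord)
    show "?P (\<lambda>x. - f x)" if "?P f" for f
      using that hom_inv[of f] inv[of f] inv(1)[of "h f"] hom_closed[of f] by auto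
    show "?P (\<lambda>x. f x + g x)" if "?P f" "?P g" for f g
      using that hom_mult[of f g] G.m_closed[of f g] by (auto simp: ops)
    show "?P (\<lambda>x. max (f x) (g x))" if "?P f" "?P g" for f g
      using that h_lsup[of f g] G.lsup_closed[of f g] by (auto simp: ops)
    show "?P (\<lambda>x. min (f x) (g x))" if "?P f" "?P g" for f g
      using that h_linf[of f g] G.linf_closed[of f g] by (auto simp: ops)
  qed
  then show ?thesis by blast
qed

lemma hopfian_free_lgroup: "hopfian (free_lgroup :: (real^'n \<Rightarrow> real) lgroup)"
  unfolding hopfian_def
proof (intro ballI impI)
  let ?A = "free_lgroup :: (real^'n \<Rightarrow> real) lgroup"
  fix h assume h: "h \<in> lhom ?A ?A" and onto: "h ` carrier ?A = carrier ?A"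
  define g :: "real^'n \<Rightarrow> real^'n" where "g x = (\<chi> i. h (\<lambda>x. x $ i) x)" for x
  have h_eq: "h f = (\<lambda>x. f (g x))" if "f \<in> carrier ?A" for f
    unfolding g_def using free_lgroup_endo_eq_compose[OF h that] .
  have coord: "(\<lambda>x. x $ i) \<in> carrier ?A" for i
    by (simp add: int_linear_in_free_lgroup int_linear_coord)
  have comp: "h (\<lambda>x. x $ i) \<in> carrier ?A" for i
    using coord onto by blast
  have "inj g"
  proof (rule injI)
    fix x y assume "g x = g y"
    have "x $ i = y $ i" for i
    proof -
      obtain f where "f \<in> carrier ?A" "(\<lambda>x. x $ i) = h f"
        using coord[of i] onto by blast
      then have "(\<lambda>x. x $ i) = (\<lambda>x. f (g x))"
        using h_eq by simp
      then show ?thesis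
        using \<open>g x = g y\<close> by metis
    qed
    then show "x = y"
      by (simp add: vec_eq_iff)
  qed
  moreover have "continuous_on UNIV g"
    unfolding g_def using comp by (intro continuous_on_vec_lambda) (simp add: free_lgroup_def)
  ultimately have "open (range g)"
    using invariance_of_domain by blast
  have homog: "g (t *\<^sub>R x) = t *\<^sub>R g x" if "t \<ge> 0" for t x
    using free_lgroup_homogeneous[OF comp that] by (simp add: g_def vec_eq_iff)
  have "g 0 = 0"
    using homog[of 0] by simp
  then have "0 \<in> range g"
    by (metis rangeI)
  with \<open>open (range g)\<close> obtain e where e: "e > 0" "cball 0 e \<subseteq> range g"
    using open_contains_cball by blast
  have "y \<in> range g" for y
  proof (cases "y = 0")
    case False
    \<comment> \<open>Shrink \<open>y\<close> along its ray into the ball, then scale the preimage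
      back up by homogeneity.\<close>
    then have "(e / norm y) *\<^sub>R y \<in> cball 0 e"
      using e(1) by simp
    then obtain x where "g x = (e / norm y) *\<^sub>R y"
      using e(2) by (metis imageE subsetD)
    then have "g ((norm y / e) *\<^sub>R x) = y"
      using False e(1) by (simp add: homog)
    then show ?thesis by (metis rangeI)
  qed (use \<open>0 \<in> range g\<close> in simp)
  then have "surj g"
    by blast
  have "inj_on h (carrier ?A)"
  proof (rule inj_onI)
    fix f1 f2 assume "f1 \<in> carrier ?A" "f2 \<in> carrier ?A" "h f1 = h f2"
    then have "(\<lambda>x. f1 (g x)) = (\<lambda>x. f2 (g x))"
      using h_eq by simp
    then have "f1 (g x) = f2 (g x)" for x
      by (rule fun_cong)
    with \<open>surj g\<close> show "f1 = f2"
      by (metis ext surjD)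
  qed
  with h onto show "h \<in> lauto ?A"
    by (simp add: lauto_def bij_betw_def)
qed

section \<open>Shears of the plane, and part (ii)\<close>

text \<open>The parameter \<open>k\<close> covers both the shear (\<open>k = 1\<close>) and its
  inverse (\<open>k = -1\<close>); both have integer coefficients.\<close>

lemma int_linear_compose_shear:
  fixes l :: "real^2 \<Rightarrow> real"
  assumes "int_linear l"
  shows "int_linear (\<lambda>v :: real^2. l (vector [v $ 1, of_int k * v $ 1 + v $ 2]))"
proof -
  obtain a where "\<And>x. l x = (\<Sum>i\<in>UNIV. of_int (a $ i) * x $ i)"
    using assms by (auto simp: int_linear_def)
  then show ?thesis
    unfolding int_linear_def
    by (intro exI[of _ "vector [a $ 1 + k * a $ 2, a $ 2]"]) (simp add: sum_2 algebra_simps)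
qed

lemma continuous_on_shear:
  "continuous_on UNIV (\<lambda>v :: real^2. vector [v $ 1, c * v $ 1 + v $ 2] :: real^2)"
  by (intro continuous_on_componentwise[THEN iffD2])
    (auto simp: Basis_vec_def inner_axis forall_2 intro!: continuous_intros)

lemma compose_shear_in_free_lgroup:
  fixes f :: "real^2 \<Rightarrow> real"
  assumes "f \<in> carrier free_lgroup"
  shows "(\<lambda>v :: real^2. f (vector [v $ 1, of_int k * v $ 1 + v $ 2])) \<in> carrier free_lgroup"
proof -
  let ?s = "\<lambda>v :: real^2. vector [v $ 1, of_int k * v $ 1 + v $ 2] :: real^2"
  obtain L where L: "finite L" "\<And>l. l \<in> L \<Longrightarrow> int_linear l" "\<And>x. \<exists>l\<in>L. f x = l x"
    and cont: "continuous_on UNIV f"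
    using assms unfolding free_lgroup_def piecewise_int_linear_def by auto
  have "piecewise_int_linear (\<lambda>v. f (?s v))"
    unfolding piecewise_int_linear_def
    using L int_linear_compose_shear by (intro exI[of _ "(\<lambda>l v. l (?s v)) ` L"]) auto
  moreover have "continuous_on UNIV (\<lambda>v. f (?s v))"
    by (intro continuous_on_compose2[OF cont continuous_on_shear]) auto
  ultimately show ?thesis
    by (simp add: free_lgroup_def)
qed

lemma not_hopfian_quotient:
  "\<not> hopfian ((free_lgroup :: (real^2 \<Rightarrow> real) lgroup) LMod quadrant_ideal)"
proof
  let ?A = "free_lgroup :: (real^2 \<Rightarrow> real) lgroup"
  let ?Q = "?A LMod quadrant_ideal"
  assume hopf: "hopfian ?Q"
  interpret G: lgroup ?A
    by (rule lgroup_free_lgroup)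
  interpret R: lgroup_hom ?A real_fun_lgroup restrict_quadrant
    by (rule restrict_quadrant_hom)
  note kernel = quadrant_ideal_eq_kernel[symmetric]
  define C where "C f = quadrant_ideal #>\<^bsub>?A\<^esub> f" for f
  have C_eq: "C f = {g \<in> carrier ?A. \<forall>v\<in>first_quadrant. g v = f v}" if "f \<in> carrier ?A" for f
    using R.kernel_coset[OF that]
    by (auto simp: kernel C_def restrict_quadrant_def fun_eq_iff split: if_splits)
  have C_eq_iff: "C f = C g \<longleftrightarrow> (\<forall>v\<in>first_quadrant. f v = g v)"
    if "f \<in> carrier ?A" "g \<in> carrier ?A" for f g
    using that by (fastforce simp: C_eq)
  have carrier: "carrier ?Q = C ` carrier ?A"
    using R.carrier_lquot by (auto simp: kernel C_def)
  have C_ops: "C f \<otimes>\<^bsub>?Q\<^esub> C g = C (f \<otimes>\<^bsub>?A\<^esub> g)" "C f \<curlyvee>\<^bsub>?Q\<^esub> C g = C (f \<curlyvee>\<^bsub>?A\<^esub> g)"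
    "C f \<curlywedge>\<^bsub>?Q\<^esub> C g = C (f \<curlywedge>\<^bsub>?A\<^esub> g)" if "f \<in> carrier ?A" "g \<in> carrier ?A" for f g
    using R.coset_mult[OF that] R.coset_lsup[OF that] R.coset_linf[OF that]
    by (simp_all add: kernel C_def)
  define E :: "int \<Rightarrow> (real^2 \<Rightarrow> real) \<Rightarrow> real^2 \<Rightarrow> real"
    where "E k f v = f (vector [v $ 1, of_int k * v $ 1 + v $ 2])" for k f v
  have E_closed: "E k f \<in> carrier ?A" if "f \<in> carrier ?A" for k f
    using compose_shear_in_free_lgroup[OF that] by (simp add: E_def[abs_def])
  have E_inverse: "E 1 (E (-1) f) = f" for f
  proof
    fix v :: "real^2"
    have "vector [v $ 1, v $ 2] = v"
      by (simp add: vec_eq_iff forall_2)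
    then show "E 1 (E (-1) f) v = f v"
      by (simp add: E_def)
  qed
  have E_ops: "E 1 (f \<otimes>\<^bsub>?A\<^esub> g) = E 1 f \<otimes>\<^bsub>?A\<^esub> E 1 g" "E 1 (f \<curlyvee>\<^bsub>?A\<^esub> g) = E 1 f \<curlyvee>\<^bsub>?A\<^esub> E 1 g"
    "E 1 (f \<curlywedge>\<^bsub>?A\<^esub> g) = E 1 f \<curlywedge>\<^bsub>?A\<^esub> E 1 g" for f g
    by (simp_all add: free_lgroup_def E_def fun_eq_iff)
  \<comment> \<open>The shear with \<open>k = 1\<close> maps the quadrant into itself, so values off
    the quadrant do not matter. The inverse shear leaves the quadrant and induces no map on
    cosets.\<close>
  have E_cong: "C (E 1 f) = C (E 1 g)" if "f \<in> carrier ?A" "g \<in> carrier ?A" "C f = C g" for f g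
    using that by (simp add: C_eq_iff E_closed) (simp add: E_def first_quadrant_def)
  define H where "H X = C (E 1 (SOME f. f \<in> carrier ?A \<and> X = C f))" for X
  have H_C: "H (C f) = C (E 1 f)" if "f \<in> carrier ?A" for f
  proof -
    define g where "g = (SOME g. g \<in> carrier ?A \<and> C f = C g)"
    have "g \<in> carrier ?A \<and> C f = C g"
      unfolding g_def by (rule someI[of _ f]) (simp add: that)
    then have "C (E 1 f) = C (E 1 g)"
      using E_cong[OF that] by blast
    then show ?thesis
      by (simp add: H_def g_def)
  qed
  have "H \<in> lhom ?Q ?Q"
    unfolding lhom_def hom_def carrier
    by (auto simp: C_ops H_C E_closed E_ops G.lsup_closed G.linf_closed)
  moreover have "H ` carrier ?Q = carrier ?Q"
  proof (intro equalityI subsetI)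
    fix X assume "X \<in> carrier ?Q"
    then obtain f where f: "f \<in> carrier ?A" "X = C f"
      by (auto simp: carrier)
    \<comment> \<open>A preimage needs only one function in its class, so \<open>E (-1)\<close> can
      be applied to the representative \<open>f\<close>.\<close>
    then have "X = H (C (E (-1) f))"
      by (simp add: H_C E_closed E_inverse)
    then show "X \<in> H ` carrier ?Q"
      using f E_closed by (auto simp: carrier)
  qed (auto simp: carrier H_C E_closed)
  ultimately have "inj_on H (carrier ?Q)"
    using hopf by (auto simp: hopfian_def lauto_def bij_betw_def)
  \<comment> \<open>\<open>p\<close> is positive exactly below the diagonal. The sheared quadrant
    lies on or above it, so \<open>H\<close> sends the class of \<open>p\<close> to zero, while
    \<open>p\<close> is 1 at the quadrant point \<open>(1, 0)\<close>.\<close>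
  define p :: "real^2 \<Rightarrow> real" where "p v = max 0 (v $ 1 - v $ 2)" for v
  have zero: "(\<lambda>v. 0) \<in> carrier ?A"
    by (intro int_linear_in_free_lgroup int_linear_zero)
  have "(\<lambda>v. v $ 1 - v $ 2) \<in> carrier ?A"
    using int_linear_add[OF int_linear_coord int_linear_uminus[OF int_linear_coord]]
    by (intro int_linear_in_free_lgroup) simp
  from G.lsup_closed[OF zero this] have p: "p \<in> carrier ?A"
    by (simp add: free_lgroup_def p_def[abs_def])
  have "H (C p) = H (C (\<lambda>v. 0))"
    using p zero by (simp add: H_C C_eq_iff E_closed) (simp add: E_def p_def first_quadrant_def)
  then have "C p = C (\<lambda>v. 0)"
    using \<open>inj_on H (carrier ?Q)\<close> p zero by (auto simp: carrier dest: inj_onD)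
  then have "\<forall>v\<in>first_quadrant. p v = 0"
    using p zero by (simp add: C_eq_iff)
  moreover have "vector [1, 0] \<in> first_quadrant" "p (vector [1, 0]) = 1"
    by (simp_all add: first_quadrant_def p_def)
  ultimately show False
    by force
qed

theorem corollary6p4:
  shows "hopfian (free_lgroup :: (real^'n \<Rightarrow> real) lgroup) \<and>
    \<not> hopfian ((free_lgroup :: (real^2 \<Rightarrow> real) lgroup) LMod quadrant_ideal)"
  using hopfian_free_lgroup not_hopfian_quotient by blast

end
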